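(* Let $S=\langle f_1,f_2,f_3,\ldots,f_n,\ldots\rangle$ be a nearly abelian cancellative transcendental semigroup whose set of commutators $\Phi(S)$ is pre-compact. Let $G=\langle\Phi(S)\rangle$ be the group (under composition) generated by $\Phi(S)$. Then every element $f\in S$ can be written in the form $$f=\phi\circ f_1^{t_1}\circ f_2^{t_2}\circ f_3^{t_3}\circ\cdots\circ f_m^{t_m}$$ for some $m\in\mathbb{N}$ and some non-negative integers $t_1,\ldots,t_m$, where $\phi\in\Phi(S)$ if $\Phi(S)$ is a group or a semigroup under composition, and $\phi\in G$ otherwise.
   Context: A transcendental semigroup $S=\langle f_\alpha\rangle$ is the set of all finite compositions $f_{\alpha_1}\circ\cdots\circ f_{\alpha_m}$ ($m\ge 1$) of members of a family $\{f_\alpha\}$ of transcendental entire functions $\mathbb{C}\to\mathbb{C}$ (the generators). In the statement the generators are indexed as a finite or infinite sequence $f_1,f_2,\ldots$. $f^t$ denotes the $t$-th iterate of $f$, with $f^0$ the identity. Fatou set: $S$ is normal on a domain $D$ if every sequence of elements of $S$ has a subsequence which either converges uniformly on all compact subsets of $D$ or diverges to $\infty$ uniformly on all compact subsets of $D$. $F(S)$ is the set of $z\in\mathbb{C}$ such that $S$ is normal in some neighbourhood of $z$. Nearly abelian: $S$ is nearly abelian if there is a family $\Phi=\{\phi_i\}$ of conformal maps $\mathbb{C}\to\mathbb{C}$ (bijective and holomorphic) such that (1) $\phi_i(F(S))=F(S)$ for all $\phi_i\in\Phi$, and (2) for all $f,g\in S$ there is $\phi\in\Phi$ with $f\circ g=\phi\circ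 g\circ f$. Cancellative: $S$ is right cancellative if $f\circ g=h\circ g$ implies $f=h$, left cancellative if $f\circ g=f\circ h$ implies $g=h$ (for all $f,g,h\in S$), and cancellative if it is both. Commutators: $\Phi(S)$ is the set of entire functions $\phi$ for which there are $f,g\in S$ with $f\circ g=\phi\circ g\circ f$. $\Phi(S)$ is pre-compact if every sequence in $\Phi(S)$ has a subsequence converging uniformly on $\mathbb{C}$ to a non-constant holomorphic function. *)

theory Defs
  imports
    "HOL-Complex_Analysis.Complex_Analysis"
    "HOL-Algebra.Generated_Groups"
    "HOL-Algebra.Bij"
    "HOL-Library.Extended_Nat"
begin

definition transcendental_entire :: "(complex \<Rightarrow> complex) \<Rightarrow> bool" where
  "transcendental_entire f \<longleftrightarrow> f holomorphic_on UNIV \<and> \<not> (\<exists>p. f = poly p)"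

text \<open>\<open>compose_list [f\<^sub>1, \<dots>, f\<^sub>m] = f\<^sub>1 \<circ> \<dots> \<circ> f\<^sub>m\<close>\<close>

definition compose_list :: "('a \<Rightarrow> 'a) list \<Rightarrow> 'a \<Rightarrow> 'a" where
  "compose_list fs = foldr (\<circ>) fs id"

definition generated_semigroup :: "('a \<Rightarrow> 'a) set \<Rightarrow> ('a \<Rightarrow> 'a) set" where
  "generated_semigroup A = {compose_list fs | fs. fs \<noteq> [] \<and> set fs \<subseteq> A}"

definition converges_locally_uniformly ::
    "(nat \<Rightarrow> complex \<Rightarrow> complex) \<Rightarrow> complex set \<Rightarrow> bool" where
  "converges_locally_uniformly s D \<longleftrightarrow>
     (\<exists>g. \<forall>K. compact K \<and> K \<subseteq> D \<longrightarrow> uniform_limit K s g sequentially)"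

definition diverges_locally_uniformly ::
    "(nat \<Rightarrow> complex \<Rightarrow> complex) \<Rightarrow> complex set \<Rightarrow> bool" where
  "diverges_locally_uniformly s D \<longleftrightarrow>
     (\<forall>K. compact K \<and> K \<subseteq> D \<longrightarrow>
        (\<forall>B::real. \<forall>\<^sub>F n in sequentially. \<forall>z\<in>K. norm (s n z) > B))"

definition normal_on :: "(complex \<Rightarrow> complex) set \<Rightarrow> complex set \<Rightarrow> bool" where
  "normal_on S D \<longleftrightarrow>
     (\<forall>s::nat \<Rightarrow> complex \<Rightarrow> complex. range s \<subseteq> S \<longrightarrow>
        (\<exists>r::nat \<Rightarrow> nat. strict_mono r \<and>
           (converges_locally_uniformly (s \<circ> r) D \<or> diverges_locally_uniformly (s \<circ> r) D)))"

definition Fatou_set :: "(complex \<Rightarrow> complex) set \<Rightarrow> complex set" where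
  "Fatou_set S = {z. \<exists>D. open D \<and> connected D \<and> z \<in> D \<and> normal_on S D}"

definition conformal_automorphism :: "(complex \<Rightarrow> complex) \<Rightarrow> bool" where
  "conformal_automorphism \<phi> \<longleftrightarrow> bij \<phi> \<and> \<phi> holomorphic_on UNIV"

definition nearly_abelian :: "(complex \<Rightarrow> complex) set \<Rightarrow> bool" where
  "nearly_abelian S \<longleftrightarrow>
     (\<exists>\<Phi>. (\<forall>\<phi>\<in>\<Phi>. conformal_automorphism \<phi>) \<and>
          (\<forall>\<phi>\<in>\<Phi>. \<phi> ` Fatou_set S = Fatou_set S) \<and>
          (\<forall>f\<in>S. \<forall>g\<in>S. \<exists>\<phi>\<in>\<Phi>. f \<circ> g = \<phi> \<circ> g \<circ> f))"

definition right_cancellative :: "('a \<Rightarrow> 'a) set \<Rightarrow> bool" where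
  "right_cancellative S \<longleftrightarrow> (\<forall>f\<in>S. \<forall>g\<in>S. \<forall>h\<in>S. f \<circ> g = h \<circ> g \<longrightarrow> f = h)"

definition left_cancellative :: "('a \<Rightarrow> 'a) set \<Rightarrow> bool" where
  "left_cancellative S \<longleftrightarrow> (\<forall>f\<in>S. \<forall>g\<in>S. \<forall>h\<in>S. f \<circ> g = f \<circ> h \<longrightarrow> g = h)"

definition cancellative :: "('a \<Rightarrow> 'a) set \<Rightarrow> bool" where
  "cancellative S \<longleftrightarrow> right_cancellative S \<and> left_cancellative S"

definition commutator_set :: "(complex \<Rightarrow> complex) set \<Rightarrow> (complex \<Rightarrow> complex) set" where
  "commutator_set S =
     {\<phi>. \<phi> holomorphic_on UNIV \<and> (\<exists>f\<in>S. \<exists>g\<in>S. f \<circ> g = \<phi> \<circ> g \<circ> f)}"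

text \<open>Convergence here is uniform on the whole plane, not merely on compact sets.\<close>

definition pre_compact :: "(complex \<Rightarrow> complex) set \<Rightarrow> bool" where
  "pre_compact \<Phi> \<longleftrightarrow>
     (\<forall>s::nat \<Rightarrow> complex \<Rightarrow> complex. range s \<subseteq> \<Phi> \<longrightarrow>
        (\<exists>(r::nat \<Rightarrow> nat) g. strict_mono r \<and> uniform_limit UNIV (s \<circ> r) g sequentially \<and>
           g holomorphic_on UNIV \<and> \<not> g constant_on UNIV))"

definition semigroup_under_comp :: "('a \<Rightarrow> 'a) set \<Rightarrow> bool" where
  "semigroup_under_comp \<Phi> \<longleftrightarrow> (\<forall>\<phi>\<in>\<Phi>. \<forall>\<psi>\<in>\<Phi>. \<phi> \<circ> \<psi> \<in> \<Phi>)"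

definition group_under_comp :: "('a \<Rightarrow> 'a) set \<Rightarrow> bool" where
  "group_under_comp \<Phi> \<longleftrightarrow> Group.group \<lparr>carrier = \<Phi>, mult = (\<circ>), one = id\<rparr>"

text \<open>
  The generated group is formed inside the group of all bijections of the type. This is meaningful
  only for a set of bijections; the commutators of a nearly abelian semigroup of nonconstant entire
  functions are such a set, since a commutator is determined by its values on the (open) image
  of \<open>g \<circ> f\<close> and so coincides with one of the conformal maps witnessing near commutativity.
\<close>

definition generated_group :: "('a \<Rightarrow> 'a) set \<Rightarrow> ('a \<Rightarrow> 'a) set" where
  "generated_group \<Phi> = generate (BijGroup UNIV) \<Phi>"

end

(* A letter g in a word u g v can be brought to the very front at the cost of one commutator,
   (u g) v = phi (g u) v, and phi then stays to the left of everything. Pulling letters to the front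
   one after another, in the reverse of the desired order, therefore sorts the word, and the
   commutators accumulate on the left only: none of them ever has to be moved past an element
   of S. *)

theory Submission
  imports Defs "HOL-Library.Multiset"
begin

lemma compose_list_Nil [simp]: "compose_list [] = id"
  and compose_list_Cons [simp]: "compose_list (g # gs) = g \<circ> compose_list gs"
  by (simp_all add: compose_list_def)

lemma compose_list_append [simp]: "compose_list (fs @ gs) = compose_list fs \<circ> compose_list gs"
  by (induction fs) (simp_all add: comp_assoc)

lemma compose_list_replicate [simp]: "compose_list (replicate n g) = g ^^ n"
  by (induction n) simp_all

lemma compose_list_concat: "compose_list (concat gss) = compose_list (map compose_list gss)"
  by (induction gss) simp_all

lemma compose_list_in_generated_semigroup:
  "fs \<noteq> [] \<Longrightarrow> set fs \<subseteq> A \<Longrightarrow> compose_list fs \<in> generated_semigroup A"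
  by (auto simp: generated_semigroup_def)

lemma compose_list_permute:
  assumes C: "id \<in> C" "semigroup_under_comp C"
    and comm: "\<And>a b. a \<in> generated_semigroup A \<Longrightarrow> b \<in> generated_semigroup A \<Longrightarrow>
                 \<exists>\<phi>\<in>C. a \<circ> b = \<phi> \<circ> b \<circ> a"
    and "mset fs = mset gs" "set fs \<subseteq> A"
  shows "\<exists>\<phi>\<in>C. compose_list fs = \<phi> \<circ> compose_list gs"
proof -
  \<comment> \<open>\<open>ps\<close> is the part that is already sorted.\<close>
  have "\<exists>\<phi>\<in>C. compose_list (ps @ fs) = \<phi> \<circ> compose_list (gs @ ps)"
    if "mset fs = mset gs" "set fs \<subseteq> A" "set ps \<subseteq> A" for ps
    using that
  \<comment> \<open>Peeling \<open>gs\<close> from its right end makes the last target letter the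
    first one to be pulled. \<open>ps\<close> stays arbitrary because each pulled letter is put in
    front of it.\<close>
  proof (induction gs arbitrary: fs ps rule: rev_induct)
    case Nil
    then show ?case using C(1) by (intro bexI[of _ id]) auto
  next
    case (snoc g gs)
    have "g \<in> set fs"
      using snoc.prems(1) by (metis in_set_conv_decomp set_mset_mset)
    then obtain u v where fs: "fs = u @ g # v"
      by (meson split_list)
    have A: "set u \<subseteq> A" "set v \<subseteq> A" "g \<in> A"
      using snoc.prems(2) fs by auto
    have "\<exists>\<phi>\<in>C. compose_list (ps @ u) \<circ> g = \<phi> \<circ> g \<circ> compose_list (ps @ u)"
    \<comment> \<open>An empty prefix composes to \<open>id\<close>, which need not belong to the
      generated semigroup, so \<open>comm\<close> cannot be applied to it; but \<open>id\<close>
      commutes with \<open>g\<close> anyway.\<close>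
    proof (cases "ps @ u = []")
      case True
      then show ?thesis using C(1) by (intro bexI[of _ id]) auto
    next
      case False
      then show ?thesis
        using compose_list_in_generated_semigroup[of "ps @ u" A]
          compose_list_in_generated_semigroup[of "[g]" A] A snoc.prems(3)
        by (intro comm) simp_all
    qed
    then obtain \<phi> where \<phi>: "\<phi> \<in> C"
      "compose_list (ps @ u) \<circ> g = \<phi> \<circ> g \<circ> compose_list (ps @ u)" by blast
    have "mset (u @ v) = mset gs" "set (u @ v) \<subseteq> A" "set (g # ps) \<subseteq> A"
      using snoc.prems fs A by auto
    then obtain \<psi> where \<psi>: "\<psi> \<in> C"
      "compose_list ((g # ps) @ (u @ v)) = \<psi> \<circ> compose_list (gs @ (g # ps))"
      using snoc.IH by blast
    have "compose_list (ps @ fs) = (compose_list (ps @ u) \<circ> g) \<circ> compose_list v"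
      by (simp add: fs comp_assoc)
    also have "\<dots> = \<phi> \<circ> compose_list ((g # ps) @ (u @ v))"
      unfolding \<phi>(2) by (simp add: comp_assoc)
    also have "\<dots> = (\<phi> \<circ> \<psi>) \<circ> compose_list ((gs @ [g]) @ ps)"
      unfolding \<psi>(2) by (simp add: comp_assoc)
    finally show ?case
      using C(2) \<phi>(1) \<psi>(1) unfolding semigroup_under_comp_def by blast
  qed
  from this[of "[]"] show ?thesis using assms by simp
qed

text \<open>Counting sort, which supplies the target word for \<open>compose_list_permute\<close>:
  distinctness of \<open>ys\<close> gives each letter a single block, and the inclusion ensures that
  no letter of \<open>xs\<close> is lost.\<close>

lemma mset_concat_replicate_count:
  assumes "set xs \<subseteq> set ys" "distinct ys"
  shows "mset (concat (map (\<lambda>y. replicate (count (mset xs) y) y) ys)) = mset xs"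
proof (rule multiset_eqI)
  fix x
  have "count (mset (concat (map (\<lambda>y. replicate (k y) y) ys))) x = (if x \<in> set ys then k x else 0)"
    for k :: "'a \<Rightarrow> nat"
    using assms(2) by (induction ys) auto
  moreover have "x \<notin> set ys \<Longrightarrow> count (mset xs) x = 0"
    using assms(1) by (auto simp: count_eq_zero_iff)
  ultimately show "count (mset (concat (map (\<lambda>y. replicate (count (mset xs) y) y) ys))) x
      = count (mset xs) x"
    by simp
qed

text \<open>\<open>C\<close> is left abstract so that one sorting argument serves both the
  commutator set, when it is closed under composition, and the bijections in the generated group
  otherwise.\<close>

lemma compose_list_sorted_form:
  fixes f :: "nat \<Rightarrow> 'a \<Rightarrow> 'a"
  assumes C: "id \<in> C" "semigroup_under_comp C"
    and S: "S = generated_semigroup (f ` {i. 1 \<le> i \<and> enat i \<le> N})"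
    and comm: "\<And>a b. a \<in> S \<Longrightarrow> b \<in> S \<Longrightarrow> \<exists>\<phi>\<in>C. a \<circ> b = \<phi> \<circ> b \<circ> a"
    and "h \<in> S"
  shows "\<exists>m t \<phi>. 1 \<le> m \<and> enat m \<le> N \<and> \<phi> \<in> C \<and>
           h = \<phi> \<circ> compose_list (map (\<lambda>i. f i ^^ t i) [1..<Suc m])"
proof -
  let ?I = "{i. 1 \<le> i \<and> enat i \<le> N}"
  obtain fs where fs: "fs \<noteq> []" "set fs \<subseteq> f ` ?I" "h = compose_list fs"
    using \<open>h \<in> S\<close> S by (auto simp: generated_semigroup_def)
  \<comment> \<open>Different indices may give the same map, so the sorting is done on a word
    \<open>ks\<close> of indices.\<close>
  from fs(2) have "fs \<in> map f ` lists ?I"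
    by (auto simp flip: lists_image)
  then obtain ks where ks: "fs = map f ks" "set ks \<subseteq> ?I"
    by auto
  \<comment> \<open>The word is finite and nonempty, so a largest occurring index exists even for
    infinite \<open>N\<close>. Smaller indices that do not occur get the exponent 0.\<close>
  define m where "m = Max (set ks)"
  have "m \<in> set ks"
    unfolding m_def using fs(1) ks(1) by (intro Max_in) auto
  then have m: "1 \<le> m" "enat m \<le> N"
    using ks(2) by auto
  have "k \<le> m" if "k \<in> set ks" for k
    unfolding m_def using that by simp
  then have "set ks \<subseteq> set [1..<Suc m]"
    using ks(2) by (auto simp: less_Suc_eq_le simp del: upt_Suc)
  define t where "t = count (mset ks)"
  define js where "js = concat (map (\<lambda>i. replicate (t i) i) [1..<Suc m])"
  have "mset js = mset ks"
    unfolding js_def t_def by (rule mset_concat_replicate_count) (fact | simp)+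
  then have "mset fs = mset (map f js)"
    by (simp add: ks(1))
  then obtain \<phi> where "\<phi> \<in> C" "h = \<phi> \<circ> compose_list (map f js)"
    using compose_list_permute[OF C comm[unfolded S] _ fs(2)] fs(3) by blast
  moreover have "compose_list (map f js) = compose_list (map (\<lambda>i. f i ^^ t i) [1..<Suc m])"
    unfolding js_def map_concat compose_list_concat by (simp add: comp_def del: upt_Suc)
  ultimately show ?thesis using m by metis
qed

lemma group_imp_semigroup_under_comp: "group_under_comp \<Phi> \<Longrightarrow> semigroup_under_comp \<Phi>"
  using monoid.m_closed[OF group.is_monoid]
  by (fastforce simp: group_under_comp_def semigroup_under_comp_def)

lemma id_in_generated_group: "id \<in> generated_group \<Phi>"
  using generate.one[of "BijGroup UNIV" \<Phi>]
  by (simp add: generated_group_def BijGroup_def id_def restrict_def)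

\<comment> \<open>For maps that are not bijective, the multiplication of \<open>BijGroup\<close> is a junk value.\<close>
lemma comp_in_generated_group:
  assumes "\<phi> \<in> generated_group \<Phi>" "\<psi> \<in> generated_group \<Phi>" "bij \<phi>" "bij \<psi>"
  shows "\<phi> \<circ> \<psi> \<in> generated_group \<Phi>"
proof -
  have "\<phi> \<otimes>\<^bsub>BijGroup UNIV\<^esub> \<psi> = \<phi> \<circ> \<psi>"
    using assms(3,4) by (auto simp: BijGroup_def Bij_def compose_def extensional_def)
  then show ?thesis
    using generate.eng[of \<phi> "BijGroup UNIV" \<Phi> \<psi>] assms(1,2)
    by (simp add: generated_group_def)
qed

text \<open>A conformal map witnessing near commutativity is entire, hence itself a commutator. Its
  bijectivity is recorded for computing in \<open>BijGroup\<close>.\<close>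

lemma nearly_abelian_commutator:
  assumes "nearly_abelian S" "a \<in> S" "b \<in> S"
  shows "\<exists>\<phi>. \<phi> \<in> commutator_set S \<and> bij \<phi> \<and> a \<circ> b = \<phi> \<circ> b \<circ> a"
  using assms unfolding nearly_abelian_def commutator_set_def conformal_automorphism_def
  by blast

theorem theorem1p2:
  fixes f :: "nat \<Rightarrow> complex \<Rightarrow> complex" and N :: enat and S :: "(complex \<Rightarrow> complex) set"
  assumes "1 \<le> N"
    and "\<And>i. 1 \<le> i \<Longrightarrow> enat i \<le> N \<Longrightarrow> transcendental_entire (f i)"
    and "S = generated_semigroup (f ` {i. 1 \<le> i \<and> enat i \<le> N})"
    and "nearly_abelian S"
    and "cancellative S"
    and "pre_compact (commutator_set S)"
  shows "\<forall>h\<in>S. \<exists>(m::nat) (t::nat \<Rightarrow> nat) \<phi>. 1 \<le> m \<and> enat m \<le> N \<and>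
           \<phi> \<in> (if group_under_comp (commutator_set S) \<or> semigroup_under_comp (commutator_set S)
                then commutator_set S else generated_group (commutator_set S)) \<and>
           h = \<phi> \<circ> compose_list (map (\<lambda>i. f i ^^ t i) [1..<Suc m])"
proof
  fix h assume h: "h \<in> S"
  note comm = nearly_abelian_commutator[OF assms(4)]
  show "\<exists>(m::nat) (t::nat \<Rightarrow> nat) \<phi>. 1 \<le> m \<and> enat m \<le> N \<and>
           \<phi> \<in> (if group_under_comp (commutator_set S) \<or> semigroup_under_comp (commutator_set S)
                then commutator_set S else generated_group (commutator_set S)) \<and>
           h = \<phi> \<circ> compose_list (map (\<lambda>i. f i ^^ t i) [1..<Suc m])"
  proof (cases "group_under_comp (commutator_set S) \<or> semigroup_under_comp (commutator_set S)")
    case True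
    then have "semigroup_under_comp (commutator_set S)"
      using group_imp_semigroup_under_comp by blast
    \<comment> \<open>Here \<open>h\<close> is paired with itself:
      \<open>h \<circ> h = id \<circ> h \<circ> h\<close>.\<close>
    moreover have "id \<in> commutator_set S"
      using h by (auto simp: commutator_set_def id_def holomorphic_on_ident comp_def)
    moreover have "\<exists>\<phi>\<in>commutator_set S. a \<circ> b = \<phi> \<circ> b \<circ> a" if "a \<in> S" "b \<in> S" for a b
      using comm[OF that] by blast
    ultimately show ?thesis
      unfolding if_P[OF True] by (intro compose_list_sorted_form[OF _ _ assms(3) _ h])
  next
    case False
    \<comment> \<open>Multiplication in \<open>BijGroup\<close> is known to be composition only on
      bijections; intersecting with them yields a set closed under composition that still contains
      the conformal commutators.\<close>
    let ?C = "generated_group (commutator_set S) \<inter> Collect bij"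
    have "id \<in> ?C"
      by (simp add: id_in_generated_group)
    moreover have "semigroup_under_comp ?C"
      by (auto simp: semigroup_under_comp_def comp_in_generated_group bij_comp)
    moreover have "\<exists>\<phi>\<in>?C. a \<circ> b = \<phi> \<circ> b \<circ> a" if "a \<in> S" "b \<in> S" for a b
      using comm[OF that] by (auto simp: generated_group_def intro: generate.incl)
    ultimately obtain m t \<phi> where "1 \<le> m" "enat m \<le> N" "\<phi> \<in> ?C"
      "h = \<phi> \<circ> compose_list (map (\<lambda>i. f i ^^ t i) [1..<Suc m])"
      using compose_list_sorted_form[of ?C, OF _ _ assms(3) _ h] by blast
    then show ?thesis
      unfolding if_not_P[OF False] by blast
  qed
qed

end
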